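(* Let $Q$ be an operator (not necessarily linear) defined on $\mathrm{Dom}(Q)=\bigcap_{p\ge2}L_p(\Omega_1)$ with values in $L_2(\Omega_2)$. Suppose there exist constants $a\ge0$, $b,d,C,C_1\in(0,\infty)$ and $p_0\ge2$ such that for all $p\ge p_0$ and all $f\in\mathrm{Dom}(Q)$ $$|Q[f]|^{(2)}_p\le C_1\,p^a\Bigl[|f|^{(1)}_{Cp^b}\Bigr]^d.$$ Then for every $m>0$ the operator $Q$ is defined on the space $G_m(\Omega_1)$ and takes values in the space $G_n(\Omega_2)$, where $n=m/(am+bd)$, and there is a constant $C_2\in(0,\infty)$, independent of $f$, such that for all $f\in G_m(\Omega_1)$ $$\|Q[f]\|^{(2)}_n\le C_2\Bigl[\|f\|^{(1)}_m\Bigr]^d.$$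
   Context: $(\Omega_1,F_1,\mu_1)$ and $(\Omega_2,F_2,\mu_2)$ are probability spaces. For $j=1,2$ and $q>0$, $|f|^{(j)}_q=\bigl(\int_{\Omega_j}|f|^q\,d\mu_j\bigr)^{1/q}$ for measurable $f:\Omega_j\to\mathbb R$. For $m>0$, $G_m(\Omega_j)$ is the space of measurable $f:\Omega_j\to\mathbb R$ with $\|f\|^{(j)}_m=\sup_{p\ge2}|f|^{(j)}_p\,p^{-1/m}<\infty$. *)

theory Defs
  imports "HOL-Probability.Probability"
begin

text \<open>Real powers of extended nonnegative reals, used only for exponents \<open>r > 0\<close>
  (hence \<open>\<infinity>\<close> is mapped to \<open>\<infinity>\<close>).\<close>

definition epowr :: "ennreal \<Rightarrow> real \<Rightarrow> ennreal" (infixr \<open>epowr\<close> 80) where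
  "x epowr r = (if x = \<infinity> then \<infinity> else ennreal (enn2real x powr r))"

text \<open>The quantity \<open>(\<integral>|f|^q)^(1/q)\<close> for \<open>q > 0\<close>, with value \<open>\<infinity>\<close> when the integral diverges;
  \<open>q < 1\<close> is allowed, where it is only a quasi-norm.\<close>

definition Lp_norm :: "'a measure \<Rightarrow> real \<Rightarrow> ('a \<Rightarrow> real) \<Rightarrow> ennreal" where
  "Lp_norm M q f = (\<integral>\<^sup>+ x. ennreal (\<bar>f x\<bar> powr q) \<partial>M) epowr (1 / q)"

text \<open>Elements of the spaces below are functions rather than classes modulo null sets.\<close>

definition Lp_space :: "'a measure \<Rightarrow> real \<Rightarrow> ('a \<Rightarrow> real) set" where
  "Lp_space M q = {f \<in> borel_measurable M. Lp_norm M q f < \<infinity>}"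

definition G_norm :: "'a measure \<Rightarrow> real \<Rightarrow> ('a \<Rightarrow> real) \<Rightarrow> ennreal" where
  "G_norm M m f = (SUP p\<in>{2..}. Lp_norm M p f * ennreal (p powr (- 1 / m)))"

definition G_space :: "'a measure \<Rightarrow> real \<Rightarrow> ('a \<Rightarrow> real) set" where
  "G_space M m = {f \<in> borel_measurable M. G_norm M m f < \<infinity>}"

end

theory Submission
  imports Defs
begin

text \<open>On a probability space \<open>|f|\<^sub>q\<close> increases with \<open>q\<close>, so
  \<open>|f|\<^sub>q \<le> max q 2 powr (1/m) * \<parallel>f\<parallel>\<^sub>m\<close> holds for every \<open>q > 0\<close>, also below \<open>2\<close>. For \<open>p \<ge> 2\<close>,
  estimating \<open>|Q f|\<^sub>p\<close> by the norm with exponent \<open>max p p0 \<le> p * p0 / 2\<close> and inserting this bound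
  into the hypothesis costs a factor of order \<open>p powr (a + b * d / m) = p powr (1/n)\<close>.\<close>

lemma epowr_ennreal: "x \<ge> 0 \<Longrightarrow> ennreal x epowr r = ennreal (x powr r)"
  by (simp add: epowr_def)

lemma epowr_less_top: "x < \<infinity> \<Longrightarrow> x epowr r < \<infinity>"
  by (simp add: epowr_def)

lemma epowr_mono:
  assumes "x \<le> y" and "r \<ge> 0"
  shows "x epowr r \<le> y epowr r"
proof (cases "y = \<infinity>")
  case False
  then have "x \<noteq> \<infinity>" "y < \<infinity>"
    using assms(1) by (auto simp: top_unique less_top)
  then show ?thesis
    using assms False
    by (auto simp: epowr_def intro!: ennreal_leI powr_mono2 enn2real_mono)
qed (simp add: epowr_def)

lemma epowr_mult_ennreal:
  assumes "c > 0"
  shows "(x * ennreal c) epowr r = x epowr r * ennreal (c powr r)"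
proof (cases "x = \<infinity>")
  case True
  then show ?thesis
    using assms by (simp add: epowr_def ennreal_top_mult)
next
  case False
  then have "x * ennreal c \<noteq> \<infinity>"
    by (simp add: ennreal_mult_eq_top_iff)
  then show ?thesis
    using False assms
    by (simp add: epowr_def enn2real_mult powr_mult ennreal_mult)
qed

text \<open>With \<open>t = p / q\<close>, weighted AM-GM applied pointwise to \<open>1\<close> and
  \<open>\<bar>f x\<bar> powr q / A\<close> bounds \<open>\<bar>f x\<bar> powr p\<close> by
  \<open>A powr t\<close> times an affine function of \<open>\<bar>f x\<bar> powr q\<close> whose
  integral is \<open>1\<close>.\<close>

lemma (in prob_space) nn_integral_powr_le:
  assumes [measurable]: "f \<in> borel_measurable M"
    and p: "0 < p" "p \<le> q" and A: "A \<ge> 0"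
    and I: "(\<integral>\<^sup>+x. ennreal (\<bar>f x\<bar> powr q) \<partial>M) = ennreal A"
  shows "(\<integral>\<^sup>+x. ennreal (\<bar>f x\<bar> powr p) \<partial>M) \<le> ennreal (A powr (p / q))"
proof (cases "A = 0")
  \<comment> \<open>Division by \<open>A\<close> is impossible here, but \<open>f\<close> vanishes
    almost everywhere, because a real power is zero only at base zero.\<close>
  case True
  with I have "(\<integral>\<^sup>+x. ennreal (\<bar>f x\<bar> powr q) \<partial>M) = 0"
    by simp
  then have "AE x in M. ennreal (\<bar>f x\<bar> powr q) = 0"
    by (subst (asm) nn_integral_0_iff_AE) auto
  then have "AE x in M. ennreal (\<bar>f x\<bar> powr p) = 0"
    by eventually_elim (simp split: if_splits)
  then have "(\<integral>\<^sup>+x. ennreal (\<bar>f x\<bar> powr p) \<partial>M) = 0"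
    by (subst nn_integral_0_iff_AE) auto
  then show ?thesis by simp
next
  case False
  define t where "t = p / q"
  have t: "0 < t" "t \<le> 1" and A0: "A > 0"
    using p A False by (auto simp: t_def)
  have pt: "\<bar>f x\<bar> powr p \<le> A powr t * (1 - t) + A powr t * t / A * \<bar>f x\<bar> powr q" for x
  \<comment> \<open>Young's inequality is used for positive arguments only; at a zero of
    \<open>f\<close> the left side is \<open>0\<close>.\<close>
  proof (cases "f x = 0")
    case True
    then show ?thesis
      using t by simp
  next
    case False
    have "1 powr (1 - t) * (\<bar>f x\<bar> powr q / A) powr t \<le> (1 - t) * 1 + t * (\<bar>f x\<bar> powr q / A)"
      by (rule Youngs_inequality_0) (use t A0 False in auto)
    then have "A powr t * (\<bar>f x\<bar> powr q / A) powr t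
        \<le> A powr t * ((1 - t) + t * (\<bar>f x\<bar> powr q / A))"
      by (intro mult_left_mono) auto
    moreover have "A powr t * (\<bar>f x\<bar> powr q / A) powr t = \<bar>f x\<bar> powr p"
      using p A0 by (simp add: powr_divide powr_powr t_def)
    ultimately show ?thesis
      by (simp add: algebra_simps)
  qed
  have "(\<integral>\<^sup>+x. ennreal (\<bar>f x\<bar> powr p) \<partial>M)
      \<le> (\<integral>\<^sup>+x. ennreal (A powr t * (1 - t))
          + ennreal (A powr t * t / A) * ennreal (\<bar>f x\<bar> powr q) \<partial>M)"
    using pt t A0
    by (intro nn_integral_mono) (auto simp flip: ennreal_plus ennreal_mult intro!: ennreal_leI)
  also have "\<dots> = ennreal (A powr t * (1 - t)) + ennreal (A powr t * t / A) * ennreal A"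
    \<comment> \<open>Total mass one makes the constant term integrate to itself.\<close>
    by (subst nn_integral_add) (auto simp: nn_integral_cmult I emeasure_space_1)
  also have "\<dots> = ennreal (A powr t * (1 - t) + A powr t * t / A * A)"
    using t A0 by (simp flip: ennreal_plus ennreal_mult)
  also have "A powr t * (1 - t) + A powr t * t / A * A = A powr t"
    using A0 by (simp add: algebra_simps)
  finally show ?thesis
    by (simp add: t_def)
qed

lemma (in prob_space) Lp_norm_mono:
  assumes f: "f \<in> borel_measurable M" and p: "0 < p" "p \<le> q"
  shows "Lp_norm M p f \<le> Lp_norm M q f"
proof (cases "(\<integral>\<^sup>+x. ennreal (\<bar>f x\<bar> powr q) \<partial>M) = \<infinity>")
  case False
  then obtain A where A: "A \<ge> 0" "(\<integral>\<^sup>+x. ennreal (\<bar>f x\<bar> powr q) \<partial>M) = ennreal A"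
    by (cases "\<integral>\<^sup>+x. ennreal (\<bar>f x\<bar> powr q) \<partial>M") auto
  have "Lp_norm M p f \<le> ennreal (A powr (p / q)) epowr (1 / p)"
    unfolding Lp_norm_def using p by (intro epowr_mono nn_integral_powr_le[OF f p A]) auto
  also have "\<dots> = Lp_norm M q f"
    using p by (simp add: Lp_norm_def A epowr_ennreal powr_powr)
  finally show ?thesis .
qed (simp add: Lp_norm_def epowr_def)

lemma Lp_norm_le_G_norm:
  assumes "p \<ge> 2"
  shows "Lp_norm M p f \<le> G_norm M m f * ennreal (p powr (1 / m))"
proof -
  have "Lp_norm M p f
      = Lp_norm M p f * ennreal (p powr (- 1 / m)) * ennreal (p powr (1 / m))"
    using assms by (simp add: mult.assoc flip: ennreal_mult powr_add)
  also have "\<dots> \<le> G_norm M m f * ennreal (p powr (1 / m))"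
    unfolding G_norm_def using assms by (intro mult_right_mono SUP_upper) auto
  finally show ?thesis .
qed

text \<open>Cancelling \<open>p powr (1 / m)\<close> in each term turns growth of order
  \<open>p powr (1 / m)\<close>, with one constant for all exponents, into a bound on the
  supremum.\<close>

lemma G_norm_leI:
  assumes "\<And>p. p \<ge> 2 \<Longrightarrow> Lp_norm M p f \<le> K * ennreal (p powr (1 / m))"
  shows "G_norm M m f \<le> K"
  unfolding G_norm_def
proof (rule SUP_least)
  fix p :: real assume "p \<in> {2..}"
  then have p: "p \<ge> 2" by simp
  have "Lp_norm M p f * ennreal (p powr (- 1 / m))
      \<le> K * ennreal (p powr (1 / m)) * ennreal (p powr (- 1 / m))"
    using assms[OF p] by (intro mult_right_mono) auto
  also have "\<dots> = K"
    using p by (simp add: mult.assoc flip: ennreal_mult powr_add)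
  finally show "Lp_norm M p f * ennreal (p powr (- 1 / m)) \<le> K" .
qed

lemma G_space_subset_Lp_space:
  assumes "p \<ge> 2"
  shows "G_space M m \<subseteq> Lp_space M p"
proof
  fix f assume f: "f \<in> G_space M m"
  then have "G_norm M m f * ennreal (p powr (1 / m)) < \<infinity>"
    by (auto simp: G_space_def ennreal_mult_less_top)
  with Lp_norm_le_G_norm[OF assms] have "Lp_norm M p f < \<infinity>"
    by (rule le_less_trans)
  with f show "f \<in> Lp_space M p"
    by (simp add: G_space_def Lp_space_def)
qed

text \<open>The supremum ranges over exponents from \<open>2\<close> on, whereas
  \<open>C * p powr b\<close> may be smaller when \<open>C\<close> is small; such exponents are
  first raised to \<open>2\<close>.\<close>

lemma (in prob_space) Lp_norm_le_G_norm_max: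
  assumes "f \<in> borel_measurable M" and "q > 0"
  shows "Lp_norm M q f \<le> G_norm M m f * ennreal (max q 2 powr (1 / m))"
  by (rule order_trans[OF Lp_norm_mono Lp_norm_le_G_norm]) (use assms in auto)

theorem theorem8:
  fixes M1 :: "'a measure" and M2 :: "'b measure"
    and Q :: "('a \<Rightarrow> real) \<Rightarrow> ('b \<Rightarrow> real)"
    and Dom :: "('a \<Rightarrow> real) set"
    and a b d C C1 p0 m n :: real
  assumes "prob_space M1" and "prob_space M2"
    and Dom_def: "Dom = (\<Inter>p\<in>{2..}. Lp_space M1 p)"
    and "Q \<in> Dom \<rightarrow> Lp_space M2 2"
    and "a \<ge> 0" and "b > 0" and "d > 0" and "C > 0" and "C1 > 0" and "p0 \<ge> 2"
    and "\<And>p f. p \<ge> p0 \<Longrightarrow> f \<in> Dom \<Longrightarrow>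
      Lp_norm M2 p (Q f) \<le> ennreal (C1 * p powr a) * (Lp_norm M1 (C * p powr b) f) epowr d"
    and "m > 0" and n_def: "n = m / (a * m + b * d)"
  shows "G_space M1 m \<subseteq> Dom \<and> Q \<in> G_space M1 m \<rightarrow> G_space M2 n \<and>
    (\<exists>C2::real. C2 > 0 \<and>
      (\<forall>f\<in>G_space M1 m. G_norm M2 n (Q f) \<le> ennreal C2 * (G_norm M1 m f) epowr d))"
proof (intro conjI)
  interpret M1: prob_space M1 by fact
  interpret M2: prob_space M2 by fact
  \<comment> \<open>\<open>k\<close> compares \<open>max p p0\<close> with \<open>p\<close>,
    \<open>K\<close> compares the resulting exponent on \<open>M1\<close>, raised to at least
    \<open>2\<close>, with \<open>p powr b\<close>, and \<open>C2\<close> gathers all factors free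
    of \<open>p\<close>.\<close>
  define k where "k = p0 / 2"
  define K where "K = max (C * k powr b) 2"
  define C2 where "C2 = C1 * k powr a * K powr (d / m)"
  have k: "k \<ge> 1"
    using \<open>p0 \<ge> 2\<close> by (simp add: k_def)
  have K: "K \<ge> 2"
    by (simp add: K_def)
  have C2: "C2 > 0"
    using k K \<open>C1 > 0\<close> by (simp add: C2_def)
  \<comment> \<open>This explains the choice of \<open>n\<close>: \<open>a\<close> comes from the
    explicit power of \<open>p\<close>, and \<open>b * d / m\<close> from the \<open>d\<close>-th
    power of the norm at an exponent of order \<open>p powr b\<close>.\<close>
  have n: "1 / n = a + b * d / m"
    using \<open>m > 0\<close> by (simp add: n_def field_simps)
  show sub: "G_space M1 m \<subseteq> Dom"
    using G_space_subset_Lp_space by (fastforce simp: Dom_def)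
  \<comment> \<open>Measurability comes from the values of \<open>Q\<close> lying in
    \<open>L_2\<close>.\<close>
  have Qf: "Q f \<in> borel_measurable M2" if "f \<in> G_space M1 m" for f
    using that sub \<open>Q \<in> Dom \<rightarrow> Lp_space M2 2\<close> by (auto simp: Lp_space_def)
  have main: "G_norm M2 n (Q f) \<le> ennreal C2 * G_norm M1 m f epowr d"
    if f: "f \<in> G_space M1 m" for f
  proof (rule G_norm_leI)
    fix p :: real assume p: "p \<ge> 2"
    \<comment> \<open>The hypothesis on \<open>Q\<close> is available only from \<open>p0\<close>
      on, so smaller exponents are raised to \<open>p0\<close>.\<close>
    define r where "r = max p p0"
    define g where "g = G_norm M1 m f"
    \<comment> \<open>Since \<open>k \<ge> 1\<close> and \<open>p \<ge> 2\<close>, both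
      \<open>p\<close> and \<open>p0 = 2 * k\<close> are at most \<open>p * k\<close>.\<close>
    have "p * 1 \<le> p * k" "2 * k \<le> p * k"
      using p k by (intro mult_left_mono mult_right_mono; simp)+
    moreover have "2 * k = p0"
      by (simp add: k_def)
    ultimately have r: "r > 0" "r \<ge> p0" "r \<ge> p" "r \<le> p * k"
      using p by (auto simp: r_def)
    have "C * r powr b \<le> C * (p * k) powr b"
      using r \<open>C > 0\<close> \<open>b > 0\<close> by (intro mult_left_mono powr_mono2) auto
    also have "\<dots> = (C * k powr b) * p powr b"
      using p k by (simp add: powr_mult)
    also have "\<dots> \<le> K * p powr b"
      by (intro mult_right_mono) (auto simp: K_def)
    finally have "C * r powr b \<le> K * p powr b" .
    \<comment> \<open>The maximum with \<open>2\<close> in the definition of \<open>K\<close> serves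
      the case where \<open>C * r powr b\<close> lies below \<open>2\<close>.\<close>
    moreover have "2 * 1 \<le> K * p powr b"
      using K p \<open>b > 0\<close> by (intro mult_mono ge_one_powr_ge_zero) auto
    ultimately have *: "max (C * r powr b) 2 \<le> K * p powr b"
      by simp
    have "Lp_norm M1 (C * r powr b) f \<le> g * ennreal (max (C * r powr b) 2 powr (1 / m))"
      unfolding g_def using f r \<open>C > 0\<close>
      by (intro M1.Lp_norm_le_G_norm_max) (auto simp: G_space_def)
    also have "\<dots> \<le> g * ennreal ((K * p powr b) powr (1 / m))"
      using * \<open>m > 0\<close> by (intro mult_left_mono ennreal_leI powr_mono2) auto
    finally have "Lp_norm M1 (C * r powr b) f epowr d
        \<le> (g * ennreal ((K * p powr b) powr (1 / m))) epowr d"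
      using \<open>d > 0\<close> by (intro epowr_mono) auto
    also have "\<dots> = g epowr d * ennreal (((K * p powr b) powr (1 / m)) powr d)"
      using K p by (intro epowr_mult_ennreal) auto
    also have "((K * p powr b) powr (1 / m)) powr d = K powr (d / m) * p powr (b * d / m)"
      using K p by (simp add: powr_powr powr_mult)
    finally have 1: "Lp_norm M1 (C * r powr b) f epowr d
        \<le> g epowr d * ennreal (K powr (d / m) * p powr (b * d / m))" .
    have "r powr a \<le> (p * k) powr a"
      using r \<open>a \<ge> 0\<close> by (intro powr_mono2) auto
    then have 2: "C1 * r powr a \<le> C1 * (k powr a * p powr a)"
      using p k \<open>C1 > 0\<close> by (simp add: powr_mult mult.commute)
    have "Lp_norm M2 p (Q f) \<le> Lp_norm M2 r (Q f)"
      using p r by (intro M2.Lp_norm_mono Qf f) auto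
    also have "\<dots> \<le> ennreal (C1 * r powr a) * Lp_norm M1 (C * r powr b) f epowr d"
      using r f sub by (intro assms) auto
    also have "\<dots> \<le> ennreal (C1 * (k powr a * p powr a))
        * (g epowr d * ennreal (K powr (d / m) * p powr (b * d / m)))"
      by (intro mult_mono ennreal_leI 1 2) auto
    also have "\<dots> = g epowr d * ennreal (C1 * (k powr a * p powr a)
        * (K powr (d / m) * p powr (b * d / m)))"
      using \<open>C1 > 0\<close> by (simp add: ennreal_mult mult_ac)
    \<comment> \<open>The powers of \<open>p\<close> combine to exponent \<open>1 / n\<close>, the
      growth that \<open>G_norm_leI\<close> asks for.\<close>
    also have "C1 * (k powr a * p powr a) * (K powr (d / m) * p powr (b * d / m))
        = C2 * p powr (1 / n)"
      by (simp add: C2_def n powr_add)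
    also have "g epowr d * ennreal (C2 * p powr (1 / n))
        = ennreal C2 * g epowr d * ennreal (p powr (1 / n))"
      using C2 by (simp add: ennreal_mult mult_ac)
    finally show "Lp_norm M2 p (Q f)
        \<le> ennreal C2 * G_norm M1 m f epowr d * ennreal (p powr (1 / n))"
      by (simp add: g_def)
  qed
  \<comment> \<open>The norm estimate already yields membership, since its right side is finite on
    \<open>G_space M1 m\<close>.\<close>
  show "Q \<in> G_space M1 m \<rightarrow> G_space M2 n"
  proof
    fix f assume f: "f \<in> G_space M1 m"
    then have "ennreal C2 * G_norm M1 m f epowr d < \<infinity>"
      using epowr_less_top[of "G_norm M1 m f" d]
      by (auto simp: G_space_def ennreal_mult_less_top)
    with main[OF f] have "G_norm M2 n (Q f) < \<infinity>"
      by (rule le_less_trans)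
    with Qf[OF f] show "Q f \<in> G_space M2 n"
      by (simp add: G_space_def)
  qed
  show "\<exists>C2::real. C2 > 0 \<and>
      (\<forall>f\<in>G_space M1 m. G_norm M2 n (Q f) \<le> ennreal C2 * (G_norm M1 m f) epowr d)"
    using C2 main by blast
qed

end
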